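(* Let $(X,d)$, $(Y,\rho)$ be semimetric spaces and let $f\colon X\to Y$ be an $\eta$-quasisymmetric mapping. If the homeomorphism $\eta$ has the form $$\eta(t)=\begin{cases}\frac12+\Psi_1(t,1-t), & t\in[0,1],\\[4pt] \dfrac{1}{\frac12+\Psi_2\left(\frac1t,1-\frac1t\right)}, & t\in[1,\infty),\end{cases}$$ where $\Psi_1,\Psi_2\colon[0,1]\times[0,1]\to\mathbb{R}$ are some continuous, antisymmetric functions, strictly increasing in the first variable, such that $\Psi_1(1,0)=\Psi_2(1,0)=\frac12$, then $f$ preserves metric betweenness.
   Context: A semimetric on a nonempty set $X$ is a function $d\colon X\times X\to[0,\infty)$ with $d(x,y)=0\Leftrightarrow x=y$ and $d(x,y)=d(y,x)$; then $(X,d)$ is a semimetric space. Let $\eta\colon[0,\infty)\to[0,\infty)$ be a homeomorphism. A mapping $f\colon X\to Y$ between semimetric spaces $(X,d)$, $(Y,\rho)$ is $\eta$-quasisymmetric if it is nonconstant and $d(x,a)\leqslant t\,d(x,b)$ implies $\rho(f(x),f(a))\leqslant\eta(t)\rho(f(x),f(b))$ for all $a,b,x\in X$ and all $t>0$. A function $\Psi$ of two variables is antisymmetric if $\Psi(y,x)=-\Psi(x,y)$. For pairwise different points $x,y,z$ of a semimetric space $(X,d)$, the point $y$ lies between $x$ and $z$ if $d(x,z)=d(x,y)+d(y,z)$. A mapping $f\colon X\to Y$ preserves metric betweenness if $f(y)$ lies between $f(x)$ and $f(z)$ in $Y$ (in particular these three images are pairwise different) whenever $y$ lies between $x$ and $z$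 in $X$. *)

theory Defs
  imports "HOL-Analysis.Analysis"
begin

locale semimetric_space =
  fixes X :: "'a set" and d :: "'a \<Rightarrow> 'a \<Rightarrow> real"
  assumes nonempty: "X \<noteq> {}"
    and nonneg: "\<lbrakk>x \<in> X; y \<in> X\<rbrakk> \<Longrightarrow> 0 \<le> d x y"
    and zero: "\<lbrakk>x \<in> X; y \<in> X\<rbrakk> \<Longrightarrow> d x y = 0 \<longleftrightarrow> x = y"
    and commute: "\<lbrakk>x \<in> X; y \<in> X\<rbrakk> \<Longrightarrow> d x y = d y x"

text \<open>The gauge \<open>\<eta>\<close> is a function on \<open>[0,\<infty>)\<close>; its values at negative arguments are irrelevant.\<close>

definition quasisymmetric ::
  "(real \<Rightarrow> real) \<Rightarrow> 'a set \<Rightarrow> ('a \<Rightarrow> 'a \<Rightarrow> real) \<Rightarrow> 'b set \<Rightarrow> ('b \<Rightarrow> 'b \<Rightarrow> real) \<Rightarrow> ('a \<Rightarrow> 'b) \<Rightarrow> bool"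
  where
  "quasisymmetric \<eta> X d Y \<rho> f \<longleftrightarrow>
     (\<exists>\<theta>. homeomorphism {0..} {0..} \<eta> \<theta>) \<and>
     f \<in> X \<rightarrow> Y \<and> \<not> f constant_on X \<and>
     (\<forall>a\<in>X. \<forall>b\<in>X. \<forall>x\<in>X. \<forall>t>0.
        d x a \<le> t * d x b \<longrightarrow> \<rho> (f x) (f a) \<le> \<eta> t * \<rho> (f x) (f b))"

definition antisymmetric_on :: "'a set \<Rightarrow> ('a \<times> 'a \<Rightarrow> real) \<Rightarrow> bool"
  where "antisymmetric_on A \<Psi> \<longleftrightarrow> (\<forall>x\<in>A. \<forall>y\<in>A. \<Psi> (y, x) = - \<Psi> (x, y))"

text \<open>\<open>lies_between X d x y z\<close>: the middle point \<open>y\<close> lies between \<open>x\<close> and \<open>z\<close>.\<close>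

definition lies_between :: "'a set \<Rightarrow> ('a \<Rightarrow> 'a \<Rightarrow> real) \<Rightarrow> 'a \<Rightarrow> 'a \<Rightarrow> 'a \<Rightarrow> bool"
  where
  "lies_between X d x y z \<longleftrightarrow>
     x \<in> X \<and> y \<in> X \<and> z \<in> X \<and> x \<noteq> y \<and> y \<noteq> z \<and> x \<noteq> z \<and> d x z = d x y + d y z"

definition preserves_metric_betweenness ::
  "'a set \<Rightarrow> ('a \<Rightarrow> 'a \<Rightarrow> real) \<Rightarrow> 'b set \<Rightarrow> ('b \<Rightarrow> 'b \<Rightarrow> real) \<Rightarrow> ('a \<Rightarrow> 'b) \<Rightarrow> bool"
  where
  "preserves_metric_betweenness X d Y \<rho> f \<longleftrightarrow>
     (\<forall>x y z. lies_between X d x y z \<longrightarrow> lies_between Y \<rho> (f x) (f y) (f z))"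

end

theory Submission
  imports Defs
begin

text \<open>Put \<open>s = d x y / d x z\<close>, so that \<open>d y z / d x z = 1 - s\<close>. Antisymmetry gives
  \<open>\<eta> s + \<eta> (1 - s) = 1\<close> and \<open>1 / \<eta> (1 / s) + 1 / \<eta> (1 / (1 - s)) = 1\<close>. Adding the quasisymmetry
  estimates at \<open>x\<close> and at \<open>z\<close> with ratios \<open>s\<close>, \<open>1 - s\<close> bounds \<open>\<rho> (f x) (f y) + \<rho> (f y) (f z)\<close> above by
  \<open>\<rho> (f x) (f z)\<close>; the ratios \<open>1 / s\<close>, \<open>1 / (1 - s)\<close> give the reverse inequality.\<close>

lemma quasisymmetric_ineq:
  assumes "quasisymmetric \<eta> X d Y \<rho> f" and "a \<in> X" "b \<in> X" "x \<in> X" "t > 0"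
    and "d x a \<le> t * d x b"
  shows "\<rho> (f x) (f a) \<le> \<eta> t * \<rho> (f x) (f b)"
  using assms unfolding quasisymmetric_def by blast

text \<open>If \<open>f a = f b\<close> with \<open>a ~= b\<close>, every distance
  \<open>d a c\<close> is at most some multiple \<open>t * d a b\<close>, so quasisymmetry bounds
  the distance from \<open>f a\<close> to \<open>f c\<close> by \<open>\<eta> t * 0\<close>. Then
  \<open>f\<close> would be constant, which is excluded. This supplies the distinctness of the three
  images.\<close>

lemma quasisymmetric_inj_on:
  assumes "semimetric_space X d" and "semimetric_space Y \<rho>" and qs: "quasisymmetric \<eta> X d Y \<rho> f"
  shows "inj_on f X"
proof (rule inj_onI, rule ccontr)
  interpret X: semimetric_space X d by fact
  interpret Y: semimetric_space Y \<rho> by fact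
  have fY: "f u \<in> Y" if "u \<in> X" for u
    using qs that unfolding quasisymmetric_def by blast
  fix a b assume ab: "a \<in> X" "b \<in> X" "f a = f b" "a \<noteq> b"
  then have pos: "d a b > 0"
    using X.nonneg[of a b] X.zero[of a b] by linarith
  have "f c = f a" if c: "c \<in> X" for c
  proof -
    \<comment> \<open>The summand 1 keeps \<open>t\<close> positive even when
      \<open>c = a\<close>.\<close>
    define t where "t = d a c / d a b + 1"
    have "t > 0" "d a c \<le> t * d a b"
      using pos X.nonneg[OF \<open>a \<in> X\<close> c] by (simp_all add: t_def field_simps add_nonneg_pos)
    then have "\<rho> (f a) (f c) \<le> \<eta> t * \<rho> (f a) (f b)"
      using quasisymmetric_ineq[OF qs] ab c by blast
    moreover have "\<rho> (f a) (f b) = 0"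
      using ab fY Y.zero by simp
    ultimately show ?thesis
      using Y.nonneg[of "f a" "f c"] Y.zero[of "f a" "f c"] ab c fY by simp
  qed
  then have "f constant_on X"
    unfolding constant_on_def by blast
  then show False
    using qs by (simp add: quasisymmetric_def)
qed

lemma antisymmetric_onD:
  assumes "antisymmetric_on A \<Psi>" and "x \<in> A" "y \<in> A"
  shows "\<Psi> (y, x) = - \<Psi> (x, y)"
  using assms unfolding antisymmetric_on_def by blast

text \<open>Monotonicity, antisymmetry and monotonicity again give \<open>\<Psi> (s, 1 - s) > \<Psi>
  (0, 1 - s) = - \<Psi> (1 - s, 0) > - \<Psi> (1, 0)\<close>. Hence the denominator in the second
  branch of \<open>\<eta>\<close> is positive and can be cleared.\<close>

lemma antisymmetric_complement_gt:
  fixes \<Psi> :: "real \<times> real \<Rightarrow> real"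
  assumes anti: "antisymmetric_on {0..1} \<Psi>"
    and mono: "\<And>y. y \<in> {0..1} \<Longrightarrow> strict_mono_on {0..1} (\<lambda>x. \<Psi> (x, y))"
    and norm: "\<Psi> (1, 0) = 1/2" and s: "0 < s" "s < 1"
  shows "\<Psi> (s, 1 - s) > - 1/2"
proof -
  have "\<Psi> (0, 1 - s) < \<Psi> (s, 1 - s)"
    using strict_mono_onD[OF mono, of "1 - s" 0 s] s by simp
  moreover have "\<Psi> (1 - s, 0) < \<Psi> (1, 0)"
    using strict_mono_onD[OF mono, of 0 "1 - s" 1] s by simp
  moreover have "\<Psi> (0, 1 - s) = - \<Psi> (1 - s, 0)"
    using antisymmetric_onD[OF anti, of "1 - s" 0] s by simp
  ultimately show ?thesis
    using norm by simp
qed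

theorem theorem3p10:
  fixes X :: "'a set" and d :: "'a \<Rightarrow> 'a \<Rightarrow> real"
    and Y :: "'b set" and \<rho> :: "'b \<Rightarrow> 'b \<Rightarrow> real"
    and f :: "'a \<Rightarrow> 'b" and \<eta> :: "real \<Rightarrow> real"
    and \<Psi>\<^sub>1 \<Psi>\<^sub>2 :: "real \<times> real \<Rightarrow> real"
  assumes "semimetric_space X d" and "semimetric_space Y \<rho>"
    and "quasisymmetric \<eta> X d Y \<rho> f"
    and "\<And>t. t \<in> {0..1} \<Longrightarrow> \<eta> t = 1/2 + \<Psi>\<^sub>1 (t, 1 - t)"
    and "\<And>t. t \<in> {1..} \<Longrightarrow> \<eta> t = 1 / (1/2 + \<Psi>\<^sub>2 (1 / t, 1 - 1 / t))"
    and "continuous_on ({0..1} \<times> {0..1}) \<Psi>\<^sub>1" and "continuous_on ({0..1} \<times> {0..1}) \<Psi>\<^sub>2"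
    and "antisymmetric_on {0..1} \<Psi>\<^sub>1" and "antisymmetric_on {0..1} \<Psi>\<^sub>2"
    and "\<And>y. y \<in> {0..1} \<Longrightarrow> strict_mono_on {0..1} (\<lambda>x. \<Psi>\<^sub>1 (x, y))"
    and "\<And>y. y \<in> {0..1} \<Longrightarrow> strict_mono_on {0..1} (\<lambda>x. \<Psi>\<^sub>2 (x, y))"
    and "\<Psi>\<^sub>1 (1, 0) = 1/2" and "\<Psi>\<^sub>2 (1, 0) = 1/2"
  shows "preserves_metric_betweenness X d Y \<rho> f"
proof -
  interpret X: semimetric_space X d by fact
  interpret Y: semimetric_space Y \<rho> by fact
  note qs = assms(3)
  have fY: "f u \<in> Y" if "u \<in> X" for u
    using qs that unfolding quasisymmetric_def by blast
  \<comment> \<open>Both bounds are stated for an arbitrary base point, since they are applied at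
    each end of the triple.\<close>
  have upper: "\<rho> (f x) (f y) \<le> (1/2 + \<Psi>\<^sub>1 (s, 1 - s)) * \<rho> (f x) (f z)"
    and lower: "(1/2 + \<Psi>\<^sub>2 (s, 1 - s)) * \<rho> (f x) (f z) \<le> \<rho> (f x) (f y)"
    if "x \<in> X" "y \<in> X" "z \<in> X" "0 < s" "s < 1" "d x y = s * d x z" for x y z s
  proof -
    show "\<rho> (f x) (f y) \<le> (1/2 + \<Psi>\<^sub>1 (s, 1 - s)) * \<rho> (f x) (f z)"
      using quasisymmetric_ineq[OF qs, of y z x s] assms(4)[of s] that by simp
    \<comment> \<open>Exchanging \<open>y\<close> and \<open>z\<close> turns the ratio into
      \<open>1 / s > 1\<close>, which falls into the second branch of \<open>\<eta>\<close>.\<close>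
    have "\<rho> (f x) (f z) \<le> \<eta> (1 / s) * \<rho> (f x) (f y)"
      using quasisymmetric_ineq[OF qs, of z y x "1 / s"] that by simp
    moreover have "\<eta> (1 / s) = 1 / (1/2 + \<Psi>\<^sub>2 (s, 1 - s))"
      using assms(5)[of "1 / s"] that by simp
    moreover have "1/2 + \<Psi>\<^sub>2 (s, 1 - s) > 0"
      using antisymmetric_complement_gt[OF assms(9,11,13), of s] that by simp
    ultimately show "(1/2 + \<Psi>\<^sub>2 (s, 1 - s)) * \<rho> (f x) (f z) \<le> \<rho> (f x) (f y)"
      by (simp add: pos_le_divide_eq mult.commute)
  qed
  have "lies_between Y \<rho> (f x) (f y) (f z)" if "lies_between X d x y z" for x y z
  proof -
    from that have mem: "x \<in> X" "y \<in> X" "z \<in> X" and neq: "x \<noteq> y" "y \<noteq> z" "x \<noteq> z"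
      and sum: "d x z = d x y + d y z"
      unfolding lies_between_def by auto
    have pos: "d x y > 0" "d y z > 0"
      using X.nonneg[of x y] X.zero[of x y] X.nonneg[of y z] X.zero[of y z] mem neq by linarith+
    define s where "s = d x y / d x z"
    have s: "0 < s" "s < 1" and dxy: "d x y = s * d x z"
      using pos sum by (simp_all add: s_def)
    have dzy: "d z y = (1 - s) * d z x"
      using dxy sum X.commute mem by (simp add: algebra_simps)
    have anti: "\<Psi>\<^sub>1 (1 - s, s) = - \<Psi>\<^sub>1 (s, 1 - s)" "\<Psi>\<^sub>2 (1 - s, s) = - \<Psi>\<^sub>2 (s, 1 - s)"
      using antisymmetric_onD[OF assms(8), of s "1 - s"] antisymmetric_onD[OF assms(9), of s "1 - s"] s
      by simp_all
    have sym: "\<rho> (f z) (f y) = \<rho> (f y) (f z)" "\<rho> (f z) (f x) = \<rho> (f x) (f z)"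
      using Y.commute fY mem by auto
    have s': "0 < 1 - s" "1 - s < 1"
      using s by simp_all
    \<comment> \<open>Seen from \<open>z\<close> the ratio is \<open>1 - s\<close>; this rewriting
      brings its complement into the form to which \<open>anti\<close> applies.\<close>
    have cs: "1 - (1 - s) = s"
      by simp
    note upper_xy = upper[OF mem s dxy]
    note upper_zy = upper[OF mem(3,2,1) s' dzy, unfolded cs anti(1) sym]
    note lower_xy = lower[OF mem s dxy]
    note lower_zy = lower[OF mem(3,2,1) s' dzy, unfolded cs anti(2) sym]
    \<comment> \<open>The two coefficients of \<open>\<rho> (f x) (f z)\<close> are 1/2 plus and 1/2
      minus the same value of \<open>\<Psi>\<^sub>1\<close>, so they add up to 1. The reverse
      inequality uses the same cancellation for \<open>\<Psi>\<^sub>2\<close>.\<close>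
    have "\<rho> (f x) (f y) + \<rho> (f y) (f z) \<le> \<rho> (f x) (f z)"
      using upper_xy upper_zy by (simp add: algebra_simps)
    moreover have "\<rho> (f x) (f z) \<le> \<rho> (f x) (f y) + \<rho> (f y) (f z)"
      using lower_xy lower_zy by (simp add: algebra_simps)
    moreover have "f x \<noteq> f y" "f y \<noteq> f z" "f x \<noteq> f z"
      using quasisymmetric_inj_on[OF assms(1,2) qs] mem neq by (auto dest: inj_onD)
    ultimately show ?thesis
      unfolding lies_between_def using fY mem by simp
  qed
  then show ?thesis
    unfolding preserves_metric_betweenness_def by blast
qed

end
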